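(* If $M$ is an infinite set with the discrete metric ($d(x,y)=1$ for all $x\neq y$) and a designated origin, then $\mathrm{Lip}_0(M)$ has the symmetric strong diameter two property (SSD2P).
   Context: All Banach spaces are real. $B_X$, $S_X$ denote the closed unit ball and unit sphere of a Banach space $X$. For a metric space $(M,d)$ with designated origin $0\in M$, $\mathrm{Lip}_0(M)$ is the Banach space of Lipschitz functions $f:M\to\mathbb{R}$ with $f(0)=0$, with norm $\|f\|=\sup_{x\neq y}\frac{|f(x)-f(y)|}{d(x,y)}$. (The choice of origin does not matter up to isometric isomorphism.) A slice of $B_X$ is a set $S(B_X,f,\alpha)=\{x\in B_X: f(x)>1-\alpha\}$ with $f\in S_{X^*}$, $\alpha>0$. $X$ has the SSD2P if for every $k\in\mathbb{N}$, all slices $S_1,\dots,S_k$ of $B_X$ and every $\varepsilon>0$, there are $x_i\in S_i$ and $\varphi\in B_X$ with $\|\varphi\|>1-\varepsilon$ such that $x_i\pm\varphi\in S_i$ for every $i\in\{1,\dots,k\}$. *)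

theory Defs
  imports "HOL-Analysis.Analysis"
begin

class pointed_metric_space = metric_space +
  fixes origin :: 'a

section \<open>The Banach space of Lipschitz functions vanishing at the origin\<close>

typedef (overloaded) ('m::pointed_metric_space) lip0 =
  "{f :: 'm \<Rightarrow> real. f origin = 0 \<and> (\<exists>C. C-lipschitz_on UNIV f)}"
  morphisms lip0_apply Lip0
  by (rule exI[of _ "\<lambda>_. 0"]) (auto intro: lipschitz_on_constant)

setup_lifting type_definition_lip0

lemma lip0_eqI: "(\<And>x. lip0_apply f x = lip0_apply g x) \<Longrightarrow> f = g"
  by transfer auto

lemma lip0_apply_origin [simp]: "lip0_apply f origin = 0"
  by transfer auto

instantiation lip0 :: (pointed_metric_space) real_vector
begin

lift_definition zero_lip0 :: "'a lip0" is "\<lambda>_. 0"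
  by (auto intro: lipschitz_on_constant)

lift_definition plus_lip0 :: "'a lip0 \<Rightarrow> 'a lip0 \<Rightarrow> 'a lip0" is "\<lambda>f g x. f x + g x"
  by (auto intro: lipschitz_on_add)

lift_definition uminus_lip0 :: "'a lip0 \<Rightarrow> 'a lip0" is "\<lambda>f x. - f x"
  by (auto intro: lipschitz_on_minus)

lift_definition minus_lip0 :: "'a lip0 \<Rightarrow> 'a lip0 \<Rightarrow> 'a lip0" is "\<lambda>f g x. f x - g x"
  by (auto intro: lipschitz_on_diff)

lift_definition scaleR_lip0 :: "real \<Rightarrow> 'a lip0 \<Rightarrow> 'a lip0" is "\<lambda>c f x. c * f x"
  by (auto intro: lipschitz_on_cmult_real)

instance
  by standard (transfer; auto simp: algebra_simps)+

end

lemmas lip0_apply_simps [simp] =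
  zero_lip0.rep_eq plus_lip0.rep_eq uminus_lip0.rep_eq minus_lip0.rep_eq scaleR_lip0.rep_eq

text \<open>Inserting \<open>0\<close> only matters for a one-point metric space, where there are no
  difference quotients and the supremum of the empty set of reals would be unspecified.\<close>

definition lip0_norm :: "'m::pointed_metric_space lip0 \<Rightarrow> real" where
  "lip0_norm f = Sup (insert 0 {\<bar>lip0_apply f x - lip0_apply f y\<bar> / dist x y | x y. x \<noteq> y})"

lemma lip0_norm_bdd:
  "bdd_above (insert 0 {\<bar>lip0_apply f x - lip0_apply f y\<bar> / dist x y | x y. x \<noteq> y})"
proof -
  obtain C where C: "C-lipschitz_on UNIV (lip0_apply f)"
    using lip0_apply[of f] by auto
  have "\<bar>lip0_apply f x - lip0_apply f y\<bar> / dist x y \<le> C" if "x \<noteq> y" for x y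
    using lipschitz_onD[OF C, of x y] that by (simp add: dist_real_def divide_le_eq)
  then show ?thesis
    by (auto intro: bdd_aboveI[of _ C])
qed

lemma lip0_norm_nonneg: "0 \<le> lip0_norm f"
  unfolding lip0_norm_def by (rule cSup_upper[OF _ lip0_norm_bdd]) simp

lemma lip0_norm_bound: "\<bar>lip0_apply f x - lip0_apply f y\<bar> \<le> lip0_norm f * dist x y"
proof (cases "x = y")
  case False
  then have "\<bar>lip0_apply f x - lip0_apply f y\<bar> / dist x y \<le> lip0_norm f"
    unfolding lip0_norm_def by (intro cSup_upper[OF _ lip0_norm_bdd]) auto
  with False show ?thesis
    by (simp add: divide_le_eq)
qed simp

lemma lip0_norm_le:
  assumes "0 \<le> C" "\<And>x y. \<bar>lip0_apply f x - lip0_apply f y\<bar> \<le> C * dist x y"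
  shows "lip0_norm f \<le> C"
  unfolding lip0_norm_def
  by (rule cSup_least) (use assms in \<open>auto simp: divide_le_eq\<close>)

lemma lip0_apply_bound: "\<bar>lip0_apply f x\<bar> \<le> lip0_norm f * dist x origin"
  using lip0_norm_bound[of f x origin] by simp

lemma lip0_norm_triangle: "lip0_norm (f + g) \<le> lip0_norm f + lip0_norm g"
proof (rule lip0_norm_le)
  fix x y
  show "\<bar>lip0_apply (f + g) x - lip0_apply (f + g) y\<bar> \<le> (lip0_norm f + lip0_norm g) * dist x y"
    using lip0_norm_bound[of f x y] lip0_norm_bound[of g x y] by (simp add: distrib_right)
qed (simp add: lip0_norm_nonneg)

lemma lip0_norm_scaleR_le: "lip0_norm (a *\<^sub>R f) \<le> \<bar>a\<bar> * lip0_norm f"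
proof (rule lip0_norm_le)
  fix x y
  have "\<bar>a\<bar> * \<bar>lip0_apply f x - lip0_apply f y\<bar> \<le> \<bar>a\<bar> * (lip0_norm f * dist x y)"
    by (intro mult_left_mono lip0_norm_bound) simp
  then show "\<bar>lip0_apply (a *\<^sub>R f) x - lip0_apply (a *\<^sub>R f) y\<bar> \<le> \<bar>a\<bar> * lip0_norm f * dist x y"
    by (simp add: right_diff_distrib[symmetric] abs_mult mult.assoc)
qed (simp add: lip0_norm_nonneg)

lemma lip0_norm_scaleR: "lip0_norm (a *\<^sub>R f) = \<bar>a\<bar> * lip0_norm f"
proof (cases "a = 0")
  case True
  then show ?thesis
    using lip0_norm_scaleR_le[of a f] lip0_norm_nonneg[of "a *\<^sub>R f"] by simp
next
  case False
  have "lip0_norm f \<le> \<bar>inverse a\<bar> * lip0_norm (a *\<^sub>R f)"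
    using lip0_norm_scaleR_le[of "inverse a" "a *\<^sub>R f"] False by simp
  then have "\<bar>a\<bar> * lip0_norm f \<le> lip0_norm (a *\<^sub>R f)"
    using False by (simp add: field_simps)
  with lip0_norm_scaleR_le[of a f] show ?thesis
    by simp
qed

lemma lip0_norm_eq_0: "lip0_norm f = 0 \<longleftrightarrow> f = 0"
proof
  assume "lip0_norm f = 0"
  then show "f = 0"
    using lip0_apply_bound[of f] by (intro lip0_eqI) simp
next
  assume "f = 0"
  then show "lip0_norm f = 0"
    using lip0_norm_scaleR[of 0 f] by simp
qed

instantiation lip0 :: (pointed_metric_space) real_normed_vector
begin

definition norm_lip0 :: "'a lip0 \<Rightarrow> real" where
  "norm_lip0 = lip0_norm"

definition dist_lip0 :: "'a lip0 \<Rightarrow> 'a lip0 \<Rightarrow> real" where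
  "dist_lip0 f g = norm (f - g)"

definition sgn_lip0 :: "'a lip0 \<Rightarrow> 'a lip0" where
  "sgn_lip0 f = f /\<^sub>R norm f"

definition uniformity_lip0 :: "('a lip0 \<times> 'a lip0) filter" where
  "uniformity_lip0 = (INF e\<in>{0<..}. principal {(f, g). dist f g < e})"

definition open_lip0 :: "'a lip0 set \<Rightarrow> bool" where
  "open_lip0 U = (\<forall>f\<in>U. \<forall>\<^sub>F (f', g) in uniformity. f' = f \<longrightarrow> g \<in> U)"

instance
  by standard
    (auto simp: dist_lip0_def sgn_lip0_def uniformity_lip0_def open_lip0_def norm_lip0_def
      lip0_norm_eq_0 lip0_norm_triangle lip0_norm_scaleR)

end

instance lip0 :: (pointed_metric_space) banach
proof
  fix X :: "nat \<Rightarrow> 'a lip0"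
  assume X: "Cauchy X"
  have ptw: "\<bar>lip0_apply f x\<bar> \<le> norm f * dist x origin" for f :: "'a lip0" and x
    by (simp add: norm_lip0_def lip0_apply_bound)
  have "Cauchy (\<lambda>n. lip0_apply (X n) x)" for x
  proof (rule CauchyI)
    fix e :: real
    assume "0 < e"
    then have "0 < e / (1 + dist x origin)"
      by (simp add: add_pos_nonneg)
    then obtain N where N: "\<forall>m\<ge>N. \<forall>n\<ge>N. norm (X m - X n) < e / (1 + dist x origin)"
      using CauchyD[OF X] by blast
    have "norm (lip0_apply (X m) x - lip0_apply (X n) x) < e" if "m \<ge> N" "n \<ge> N" for m n
    proof -
      have "\<bar>lip0_apply (X m - X n) x\<bar> \<le> norm (X m - X n) * dist x origin"
        by (rule ptw)
      also have "\<dots> \<le> norm (X m - X n) * (1 + dist x origin)"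
        by (simp add: mult_left_mono)
      also have "\<dots> < e"
        using N that by (simp add: pos_less_divide_eq add_pos_nonneg)
      finally show ?thesis
        by simp
    qed
    then show "\<exists>N. \<forall>m\<ge>N. \<forall>n\<ge>N. norm (lip0_apply (X m) x - lip0_apply (X n) x) < e"
      by blast
  qed
  then have "\<forall>x. \<exists>l. (\<lambda>n. lip0_apply (X n) x) \<longlonglongrightarrow> l"
    using Cauchy_convergent convergent_def by blast
  then obtain g where g: "\<And>x. (\<lambda>n. lip0_apply (X n) x) \<longlonglongrightarrow> g x"
    by metis
  have tail: "\<bar>(lip0_apply (X m) x - g x) - (lip0_apply (X m) y - g y)\<bar> \<le> e * dist x y"
    if N: "\<forall>m\<ge>N. \<forall>n\<ge>N. norm (X m - X n) < e" and m: "m \<ge> N" for N m e x y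
  proof (rule tendsto_upperbound)
    show "(\<lambda>n. \<bar>(lip0_apply (X m) x - lip0_apply (X n) x)
              - (lip0_apply (X m) y - lip0_apply (X n) y)\<bar>)
            \<longlonglongrightarrow> \<bar>(lip0_apply (X m) x - g x) - (lip0_apply (X m) y - g y)\<bar>"
      by (intro tendsto_intros g)
    have "\<bar>(lip0_apply (X m) x - lip0_apply (X n) x) - (lip0_apply (X m) y - lip0_apply (X n) y)\<bar>
            \<le> e * dist x y" if "n \<ge> N" for n
    proof -
      have "norm (X m - X n) < e"
        using N m that by blast
      then have "norm (X m - X n) * dist x y \<le> e * dist x y"
        by (intro mult_right_mono) auto
      then show ?thesis
        using lip0_norm_bound[of "X m - X n" x y] by (simp add: norm_lip0_def)
    qed
    then show "\<forall>\<^sub>F n in sequentially. \<bar>(lip0_apply (X m) x - lip0_apply (X n) x)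
              - (lip0_apply (X m) y - lip0_apply (X n) y)\<bar> \<le> e * dist x y"
      using eventually_sequentially by blast
  qed simp
  have g0: "g origin = 0"
    using LIMSEQ_unique[OF g[of origin]] by simp
  obtain N where N: "\<forall>m\<ge>N. \<forall>n\<ge>N. norm (X m - X n) < 1"
    using CauchyD[OF X zero_less_one] by blast
  have "\<bar>g x - g y\<bar> \<le> (norm (X N) + 1) * dist x y" for x y
    using tail[OF N order_refl, of x y] lip0_norm_bound[of "X N" x y]
    by (simp add: norm_lip0_def distrib_right)
  then have "(norm (X N) + 1)-lipschitz_on UNIV g"
    by (intro lipschitz_onI) (auto simp: dist_real_def)
  with g0 have G: "lip0_apply (Lip0 g) = g"
    by (intro Lip0_inverse) auto
  have "X \<longlonglongrightarrow> Lip0 g"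
  proof (rule LIMSEQ_I)
    fix e :: real
    assume "0 < e"
    then obtain N where N: "\<forall>m\<ge>N. \<forall>n\<ge>N. norm (X m - X n) < e / 2"
      using CauchyD[OF X, of "e / 2"] by auto
    have "norm (X m - Lip0 g) < e" if "m \<ge> N" for m
    proof -
      have "norm (X m - Lip0 g) \<le> e / 2"
        unfolding norm_lip0_def
        by (rule lip0_norm_le) (use \<open>0 < e\<close> tail[OF N that] in \<open>auto simp: G\<close>)
      with \<open>0 < e\<close> show ?thesis
        by simp
    qed
    then show "\<exists>N. \<forall>m\<ge>N. norm (X m - Lip0 g) < e"
      by blast
  qed
  then show "convergent X"
    by (rule convergentI)
qed

section \<open>Slices and the symmetric strong diameter two property\<close>

definition slice :: "('a::banach \<Rightarrow>\<^sub>L real) \<Rightarrow> real \<Rightarrow> 'a set" where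
  "slice f \<alpha> = {x \<in> cball 0 1. blinfun_apply f x > 1 - \<alpha>}"

definition is_slice :: "'a::banach set \<Rightarrow> bool" where
  "is_slice S \<longleftrightarrow> (\<exists>f \<alpha>. norm f = 1 \<and> \<alpha> > 0 \<and> S = slice f \<alpha>)"

definition SSD2P :: "'a::banach itself \<Rightarrow> bool" where
  "SSD2P _ \<longleftrightarrow>
    (\<forall>k\<ge>1. \<forall>S :: nat \<Rightarrow> 'a set. \<forall>\<epsilon>>0.
      (\<forall>i\<in>{1..k}. is_slice (S i)) \<longrightarrow>
      (\<exists>x \<phi>. \<phi> \<in> cball 0 1 \<and> norm \<phi> > 1 - \<epsilon> \<and>
        (\<forall>i\<in>{1..k}. x i \<in> S i \<and> x i + \<phi> \<in> S i \<and> x i - \<phi> \<in> S i)))"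

end

theory Submission
  imports Defs
begin

text \<open>
  On a discrete space the Lipschitz norm is the oscillation, so the functions in the unit ball are
  exactly those whose values lie in some interval \<open>[c - 1/2, c + 1/2]\<close>. Consequently a
  function in the ball may be altered at finitely many points other than the origin and stays in
  the ball, provided that the new values are chosen in the same interval.

  A continuous functional hardly notices such an alteration at most points. Indeed, the indicator
  functions \<open>e\<^sub>p\<close> of single points have signed finite sums bounded by \<open>2\<close> in norm, so that
  \<open>\<Sum>\<bar>F e\<^sub>p\<bar> \<le> 2 * \<parallel>F\<parallel>\<close>, and only finitely many \<open>p\<close> other than the origin satisfy \<open>\<bar>F e\<^sub>p\<bar> \<ge> \<delta>\<close>
  (\<open>finite_points_seen_by_functional\<close>).

  Given slices, pick \<open>y\<^sub>i\<close> in the \<open>i\<close>-th one, with values within \<open>1/2\<close> of \<open>c\<^sub>i\<close>. As the space is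
  infinite, there are two points \<open>p \<noteq> q\<close> at whose indicators the finitely many functionals
  take values as small as desired. Let \<open>x\<^sub>i\<close> be \<open>y\<^sub>i\<close> with the values at \<open>p\<close> and \<open>q\<close>
  replaced by the midpoint \<open>c\<^sub>i\<close>, and let \<open>\<phi> = (e\<^sub>p - e\<^sub>q)/2\<close>, which has oscillation \<open>1\<close>.
  Then \<open>x\<^sub>i\<close> and \<open>x\<^sub>i \<plusminus> \<phi>\<close> differ from \<open>y\<^sub>i\<close> at \<open>p\<close> and \<open>q\<close> only, where they take values in
  \<open>{c\<^sub>i - 1/2, c\<^sub>i, c\<^sub>i + 1/2}\<close>; hence they all lie in the \<open>i\<close>-th slice
  (\<open>two_point_change_in_slice\<close>).
\<close>

lemma lip0_apply_sum:
  "lip0_apply (\<Sum>a\<in>A. f a) x = (\<Sum>a\<in>A. lip0_apply (f a) x)"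
  by (induction A rule: infinite_finite_induct) auto

lemma slice_nonempty:
  fixes F :: "'a::banach \<Rightarrow>\<^sub>L real"
  assumes "norm F = 1" and "\<alpha> > 0"
  shows "slice F \<alpha> \<noteq> {}"
proof
  assume empty: "slice F \<alpha> = {}"
  then have le: "blinfun_apply F x \<le> 1 - \<alpha>" if "norm x \<le> 1" for x
    using that by (force simp: slice_def)
  from le[of 0] have "1 - \<alpha> \<ge> 0"
    by simp
  have "norm F \<le> 1 - \<alpha>"
  proof (rule norm_blinfun_bound)
    fix x
    have dir: "blinfun_apply F z \<le> (1 - \<alpha>) * norm z" for z
    proof (cases "z = 0")
      case False
      then have "blinfun_apply F (z /\<^sub>R norm z) \<le> 1 - \<alpha>"
        by (intro le) simp
      with False show ?thesis
        by (simp add: blinfun.scaleR_right field_simps)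
    qed simp
    show "norm (blinfun_apply F x) \<le> (1 - \<alpha>) * norm x"
      using dir[of x] dir[of "- x"] by (simp add: blinfun.minus_right abs_le_iff)
  qed fact
  with assms show False
    by simp
qed

text \<open>This is the indicator function only if \<open>p\<close> is an isolated point other than the origin;
  otherwise that function is not Lipschitz or does not vanish at the origin, and the value is
  unspecified.\<close>

definition point_indicator :: "'m::pointed_metric_space \<Rightarrow> 'm lip0" where
  "point_indicator p = Lip0 (\<lambda>x. of_bool (x = p))"

context
  assumes discrete: "\<And>x y :: 'm::pointed_metric_space. x \<noteq> y \<Longrightarrow> dist x y = 1"
begin

lemma point_indicator_apply:
  fixes p :: 'm
  assumes "p \<noteq> origin"
  shows "lip0_apply (point_indicator p) x = of_bool (x = p)"
proof -
  have "1-lipschitz_on UNIV (\<lambda>x. of_bool (x = p) :: real)"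
    by (rule lipschitz_onI) (auto simp: discrete)
  with assms show ?thesis
    unfolding point_indicator_def by (subst Lip0_inverse) auto
qed

lemma norm_le_if_values_near:
  fixes f :: "'m lip0"
  assumes "\<And>x. \<bar>lip0_apply f x - c\<bar> \<le> r"
  shows "norm f \<le> 2 * r"
  unfolding norm_lip0_def
proof (rule lip0_norm_le)
  show "0 \<le> 2 * r"
    using assms[of origin] by simp
  show "\<bar>lip0_apply f x - lip0_apply f y\<bar> \<le> 2 * r * dist x y" for x y
    using assms[of x] assms[of y] by (cases "x = y") (auto simp: discrete)
qed

text \<open>Any two values differ by at most \<open>1\<close>, so all of them lie in \<open>[m, m + 1]\<close> for the infimum
  \<open>m\<close>, even if the supremum is smaller than \<open>m + 1\<close>.\<close>

lemma unit_ball_values_near: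
  fixes f :: "'m lip0"
  assumes "norm f \<le> 1"
  obtains c where "\<And>x. \<bar>lip0_apply f x - c\<bar> \<le> 1/2"
proof -
  have diff: "\<bar>lip0_apply f x - lip0_apply f y\<bar> \<le> 1" for x y
    using lip0_norm_bound[of f x y] assms
    by (cases "x = y") (auto simp: discrete norm_lip0_def)
  define m where "m = Inf (range (lip0_apply f))"
  have "bdd_below (range (lip0_apply f))"
    by (rule bdd_belowI[of _ "- 1"]) (use diff[of _ origin] in \<open>force simp: abs_le_iff\<close>)
  then have low: "m \<le> lip0_apply f x" for x
    unfolding m_def by (intro cInf_lower) auto
  have up: "lip0_apply f x - 1 \<le> m" for x
    unfolding m_def
    by (intro cInf_greatest) (use diff[of x] in \<open>auto simp: abs_le_iff algebra_simps\<close>)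
  show thesis
  proof (rule that)
    show "\<bar>lip0_apply f x - (m + 1/2)\<bar> \<le> 1/2" for x
      using low[of x] up[of x] by linarith
  qed
qed

text \<open>A combination of point indicators with coefficients \<open>\<plusminus>1\<close> has values in \<open>[- 1, 1]\<close>, however
  many points are used. Choosing the signs of the \<open>F e\<^sub>p\<close> as coefficients bounds \<open>\<Sum>\<bar>F e\<^sub>p\<bar>\<close>
  by \<open>2 * \<parallel>F\<parallel>\<close>, which limits the number of large terms.\<close>

lemma finite_points_seen_by_functional:
  fixes F :: "'m lip0 \<Rightarrow>\<^sub>L real"
  assumes "\<delta> > 0"
  shows "finite {p. p \<noteq> origin \<and> \<bar>blinfun_apply F (point_indicator p)\<bar> \<ge> \<delta>}"
    (is "finite ?B")
proof -
  have "card P \<le> nat \<lfloor>norm F * 2 / \<delta>\<rfloor>" if P: "P \<subseteq> ?B" "finite P" for P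
  proof -
    define g where
      "g = (\<Sum>p\<in>P. sgn (blinfun_apply F (point_indicator p)) *\<^sub>R point_indicator p)"
    have "lip0_apply g x
        = (\<Sum>p\<in>P. if p = x then sgn (blinfun_apply F (point_indicator p)) else 0)" for x
      unfolding g_def lip0_apply_sum using P
      by (intro sum.cong) (auto simp: point_indicator_apply)
    then have "\<bar>lip0_apply g x - 0\<bar> \<le> 1" for x
      using P by (auto simp: sgn_if)
    then have "norm g \<le> 2"
      using norm_le_if_values_near[of g 0 1] by simp
    have "real (card P) * \<delta> \<le> (\<Sum>p\<in>P. \<bar>blinfun_apply F (point_indicator p)\<bar>)"
      using P by (intro sum_bounded_below) auto
    also have "\<dots> = blinfun_apply F g"
      unfolding g_def
      by (auto simp: blinfun.sum_right blinfun.scaleR_right sgn_if intro!: sum.cong)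
    also have "\<dots> \<le> norm F * norm g"
      using norm_blinfun[of F g] by simp
    also have "\<dots> \<le> norm F * 2"
      using \<open>norm g \<le> 2\<close> by (intro mult_left_mono) auto
    finally have "real (card P) \<le> norm F * 2 / \<delta>"
      using assms by (simp add: field_simps)
    then show ?thesis
      by (simp add: le_nat_floor)
  qed
  then show ?thesis
    using finite_if_finite_subsets_card_bdd by blast
qed

text \<open>The old and new values at \<open>p\<close> and \<open>q\<close> lie in one interval of length \<open>1\<close>, so the
  coefficients \<open>s\<close> and \<open>t\<close> are at most \<open>1\<close> in modulus; the functional therefore loses at most
  \<open>\<bar>F e\<^sub>p\<bar> + \<bar>F e\<^sub>q\<bar>\<close>.\<close>

lemma two_point_change_in_slice:
  fixes F :: "'m lip0 \<Rightarrow>\<^sub>L real" and y :: "'m lip0"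
  assumes pq: "p \<noteq> origin" "q \<noteq> origin" "p \<noteq> q"
    and near: "\<And>x. \<bar>lip0_apply y x - c\<bar> \<le> 1/2"
    and s: "\<bar>lip0_apply y p + s - c\<bar> \<le> 1/2"
    and t: "\<bar>lip0_apply y q + t - c\<bar> \<le> 1/2"
    and small: "\<bar>blinfun_apply F (point_indicator p)\<bar> + \<bar>blinfun_apply F (point_indicator q)\<bar>
      < blinfun_apply F y - (1 - \<alpha>)"
  shows "y + s *\<^sub>R point_indicator p + t *\<^sub>R point_indicator q \<in> slice F \<alpha>"
    (is "?v \<in> _")
proof -
  have "\<bar>lip0_apply ?v x - c\<bar> \<le> 1/2" for x
    using pq near[of x] s t by (auto simp: point_indicator_apply)
  then have "norm ?v \<le> 1"
    using norm_le_if_values_near[of ?v c "1/2"] by simp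
  have "\<bar>s\<bar> \<le> 1" "\<bar>t\<bar> \<le> 1"
    using near[of p] near[of q] s t by linarith+
  then have "\<bar>s * blinfun_apply F (point_indicator p)\<bar> \<le> \<bar>blinfun_apply F (point_indicator p)\<bar>"
    "\<bar>t * blinfun_apply F (point_indicator q)\<bar> \<le> \<bar>blinfun_apply F (point_indicator q)\<bar>"
    by (auto simp: abs_mult intro: mult_left_le_one_le)
  with small have "blinfun_apply F ?v > 1 - \<alpha>"
    by (simp add: blinfun.add_right blinfun.scaleR_right)
  with \<open>norm ?v \<le> 1\<close> show ?thesis
    by (simp add: slice_def)
qed

lemma norm_half_difference_point_indicators:
  fixes p q :: 'm
  assumes pq: "p \<noteq> origin" "q \<noteq> origin" "p \<noteq> q"
  shows "norm ((1/2) *\<^sub>R point_indicator p - (1/2) *\<^sub>R point_indicator q) = 1"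
    (is "norm ?\<phi> = 1")
proof (rule antisym)
  have "\<bar>lip0_apply ?\<phi> x - 0\<bar> \<le> 1/2" for x
    using pq by (auto simp: point_indicator_apply)
  then show "norm ?\<phi> \<le> 1"
    using norm_le_if_values_near[of ?\<phi> 0 "1/2"] by simp
  show "norm ?\<phi> \<ge> 1"
    using lip0_norm_bound[of ?\<phi> p q] pq
    by (simp add: point_indicator_apply discrete norm_lip0_def)
qed

end

theorem proposition2p8:
  assumes "infinite (UNIV :: 'm::pointed_metric_space set)"
    and "\<And>x y :: 'm. x \<noteq> y \<Longrightarrow> dist x y = 1"
  shows "SSD2P TYPE('m lip0)"
  unfolding SSD2P_def
proof (intro allI impI)
  fix k :: nat and S :: "nat \<Rightarrow> 'm lip0 set" and \<epsilon> :: real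
  assume "\<epsilon> > 0" and "\<forall>i\<in>{1..k}. is_slice (S i)"
  then have "\<exists>F \<alpha> y. S i = slice F \<alpha> \<and> y \<in> slice F \<alpha>" if "i \<in> {1..k}" for i
    using that slice_nonempty unfolding is_slice_def by blast
  then obtain F \<alpha> y
    where S: "\<And>i. i \<in> {1..k} \<Longrightarrow> S i = slice (F i) (\<alpha> i)"
      and y: "\<And>i. i \<in> {1..k} \<Longrightarrow> y i \<in> slice (F i) (\<alpha> i)"
    by metis
  have "\<exists>c. \<forall>x. \<bar>lip0_apply (y i) x - c\<bar> \<le> 1/2" if "i \<in> {1..k}" for i
    using unit_ball_values_near[OF assms(2), of "y i"] y[OF that] by (auto simp: slice_def)
  then obtain c where c: "\<And>i x. i \<in> {1..k} \<Longrightarrow> \<bar>lip0_apply (y i) x - c i\<bar> \<le> 1/2"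
    by metis
  \<comment> \<open>Half of the room that \<open>y i\<close> leaves in its slice, one half for each of the two points.\<close>
  define \<delta> where "\<delta> i = (blinfun_apply (F i) (y i) - (1 - \<alpha> i)) / 2" for i
  have \<delta>: "\<delta> i > 0" if "i \<in> {1..k}" for i
    using y[OF that] by (simp add: \<delta>_def slice_def)
  define B where "B = insert origin
    (\<Union>i\<in>{1..k}. {p. p \<noteq> origin \<and> \<bar>blinfun_apply (F i) (point_indicator p)\<bar> \<ge> \<delta> i})"
  have "finite B"
    unfolding B_def using finite_points_seen_by_functional[OF assms(2)] \<delta> by blast
  obtain p where p: "p \<notin> B"
    using ex_new_if_finite[OF assms(1) \<open>finite B\<close>] by blast
  obtain q where q: "q \<notin> insert p B"
    using ex_new_if_finite[OF assms(1), of "insert p B"] \<open>finite B\<close> by blast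
  have pq: "p \<noteq> origin" "q \<noteq> origin" "p \<noteq> q"
    using p q by (auto simp: B_def)
  have small: "\<bar>blinfun_apply (F i) (point_indicator p)\<bar>
      + \<bar>blinfun_apply (F i) (point_indicator q)\<bar>
      < blinfun_apply (F i) (y i) - (1 - \<alpha> i)" if "i \<in> {1..k}" for i
  proof -
    have "\<bar>blinfun_apply (F i) (point_indicator p)\<bar> < \<delta> i"
      "\<bar>blinfun_apply (F i) (point_indicator q)\<bar> < \<delta> i"
      using p q that by (force simp: B_def)+
    then show ?thesis
      by (simp add: \<delta>_def)
  qed
  define change where "change i a b = y i + (a - lip0_apply (y i) p) *\<^sub>R point_indicator p
    + (b - lip0_apply (y i) q) *\<^sub>R point_indicator q" for i a b
  have change: "change i a b \<in> S i"
    if "i \<in> {1..k}" "\<bar>a - c i\<bar> \<le> 1/2" "\<bar>b - c i\<bar> \<le> 1/2" for i a b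
    unfolding change_def S[OF that(1)]
    by (rule two_point_change_in_slice[OF assms(2) pq c[OF that(1)]])
      (use that small in auto)
  define \<phi> where "\<phi> = (1/2) *\<^sub>R point_indicator p - (1/2) *\<^sub>R point_indicator q"
  have "norm \<phi> = 1"
    unfolding \<phi>_def using assms(2) pq by (rule norm_half_difference_point_indicators)
  moreover have "change i (c i) (c i) + \<phi> = change i (c i + 1/2) (c i - 1/2)"
    "change i (c i) (c i) - \<phi> = change i (c i - 1/2) (c i + 1/2)" for i
    by (simp_all add: change_def \<phi>_def algebra_simps)
  ultimately show "\<exists>x \<phi>. \<phi> \<in> cball 0 1 \<and> norm \<phi> > 1 - \<epsilon> \<and>
      (\<forall>i\<in>{1..k}. x i \<in> S i \<and> x i + \<phi> \<in> S i \<and> x i - \<phi> \<in> S i)"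
    using \<open>\<epsilon> > 0\<close> change
    by (intro exI[of _ "\<lambda>i. change i (c i) (c i)"] exI[of _ \<phi>]) simp
qed

end
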